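(* The separable Banach space $c_0$ does not embed quasisymmetrically into any Banach space which has an equivalent uniformly convex norm.
   Context: $c_0$ is the Banach space of scalar sequences converging to $0$, with the supremum norm. Banach spaces are regarded as metric spaces with the metric induced by the norm. Let $(M,d_M)$ and $(N,d_N)$ be metric spaces. An embedding (injective map) $f:M\to N$ is a quasisymmetric embedding with modulus $\eta:(0,\infty)\to(0,\infty)$ if $\eta$ is increasing, $\lim_{t\to 0}\eta(t)=0$, and for every distinct $x,y,z\in M$, $$\frac{d_N(f(x),f(y))}{d_N(f(x),f(z))}\le \eta\left(\frac{d_M(x,y)}{d_M(x,z)}\right).$$ $M$ embeds quasisymmetrically into $N$ if there is a quasisymmetric embedding $f:M\to N$ with some such modulus $\eta$. *)

theory Defs
  imports "HOL-Analysis.Analysis"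
begin

text \<open>
  As \<^typ>\<open>nat\<close> carries the discrete topology, the type of bounded continuous functions on it is
  the space of all bounded sequences with the supremum norm; \<open>c\<^sub>0\<close> is a closed subspace.
  The scalar field ranges over \<^class>\<open>real_normed_field\<close>, whose instances are (up to isometric
  isomorphism) the reals and the complex numbers.
\<close>

definition c0 :: "(nat \<Rightarrow>\<^sub>C 'k::real_normed_field) set" where
  "c0 = {x. apply_bcontfun x \<longlonglongrightarrow> 0}"

definition quasisymmetric_modulus :: "(real \<Rightarrow> real) \<Rightarrow> bool" where
  "quasisymmetric_modulus \<eta> \<longleftrightarrow>
     (\<forall>t>0. \<eta> t > 0) \<and> mono_on {0<..} \<eta> \<and> (\<eta> \<longlongrightarrow> 0) (at_right 0)"

definition quasisymmetric_embedding ::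
    "(real \<Rightarrow> real) \<Rightarrow> 'a::metric_space set \<Rightarrow> 'b::metric_space set \<Rightarrow> ('a \<Rightarrow> 'b) \<Rightarrow> bool" where
  "quasisymmetric_embedding \<eta> M N f \<longleftrightarrow>
     quasisymmetric_modulus \<eta> \<and> f ` M \<subseteq> N \<and> inj_on f M \<and>
     (\<forall>x\<in>M. \<forall>y\<in>M. \<forall>z\<in>M. x \<noteq> y \<longrightarrow> x \<noteq> z \<longrightarrow> y \<noteq> z \<longrightarrow>
        dist (f x) (f y) / dist (f x) (f z) \<le> \<eta> (dist x y / dist x z))"

definition embeds_quasisymmetrically ::
    "'a::metric_space set \<Rightarrow> 'b::metric_space set \<Rightarrow> bool" where
  "embeds_quasisymmetrically M N \<longleftrightarrow> (\<exists>\<eta> f. quasisymmetric_embedding \<eta> M N f)"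

definition is_norm :: "('b::real_vector \<Rightarrow> real) \<Rightarrow> bool" where
  "is_norm p \<longleftrightarrow>
     (\<forall>x. p x \<ge> 0) \<and> (\<forall>x. p x = 0 \<longleftrightarrow> x = 0) \<and>
     (\<forall>a x. p (a *\<^sub>R x) = \<bar>a\<bar> * p x) \<and>
     (\<forall>x y. p (x + y) \<le> p x + p y)"

definition equivalent_norm :: "('b::real_normed_vector \<Rightarrow> real) \<Rightarrow> bool" where
  "equivalent_norm p \<longleftrightarrow>
     is_norm p \<and> (\<exists>a>0. \<exists>b>0. \<forall>x. a * norm x \<le> p x \<and> p x \<le> b * norm x)"

definition uniformly_convex_norm :: "('b::real_vector \<Rightarrow> real) \<Rightarrow> bool" where
  "uniformly_convex_norm p \<longleftrightarrow>
     (\<forall>\<epsilon>. 0 < \<epsilon> \<and> \<epsilon> \<le> 2 \<longrightarrow>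
        (\<exists>\<delta>>0. \<forall>x y. p x = 1 \<longrightarrow> p y = 1 \<longrightarrow> p (x - y) \<ge> \<epsilon> \<longrightarrow>
           p ((1/2) *\<^sub>R (x + y)) \<le> 1 - \<delta>))"

end

theory Submission
  imports Defs
begin

text \<open>
  The argument is Kalton's proof that the unit ball of \<open>c\<^sub>0\<close> does not embed uniformly into a
  reflexive space, based on interlacing graphs, with weak limits replaced by points of nested
  convex hulls. Let \<open>F\<close> be a quasisymmetric embedding of \<open>c\<^sub>0\<close> into \<open>Y\<close>.

  Fix \<open>k\<close>. To each \<open>k\<close>-set \<open>m\<^sub>1 < \<dots> < m\<^sub>k\<close> of natural numbers corresponds the vector
  \<open>(s(m\<^sub>1) + \<dots> + s(m\<^sub>k)) / k\<close> of \<open>c\<^sub>0\<close>, where \<open>s(m)\<close> is the indicator of \<open>{0..m}\<close>. These vectors have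
  norm 1; those of interlaced sets (\<open>n\<^sub>1 \<le> m\<^sub>1 \<le> n\<^sub>2 \<le> m\<^sub>2 \<le> \<dots>\<close>) are at distance at most \<open>1/k\<close>, and
  those of sets that lie one entirely beyond the other are at distance 1. Comparing with the origin and
  with one fixed vector, quasisymmetry shows that \<open>F\<close> sends vectors of the first kind to points at
  distance at most \<open>R \<eta>(1/k)\<close>, and of the second kind to points at distance at least \<open>\<delta>\<close>, where
  \<open>R\<close> and \<open>\<delta> > 0\<close> do not depend on \<open>k\<close> (lemmas \<open>quasisymmetric_le\<close> and
  \<open>quasisymmetric_le_max\<close>).

  In a uniformly convex space, nested nonempty bounded closed convex sets have a common point
  (\<open>uniformly_convex_nested_nonempty\<close>). Hence every bounded sequence has a point lying in the closed
  convex hull of each of its tails. Taking such points successively in \<open>m\<^sub>k, \<dots>, m\<^sub>1\<close> collapses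
  the images under \<open>F\<close> of all the vectors above to a single point \<open>x\<close>. Unravelling this, choose
  \<open>n\<^sub>1\<close>, then finitely many \<open>m\<^sub>1\<close> beyond it, then \<open>n\<^sub>2\<close> beyond all of these, and so on: \<open>x\<close> is
  nearly a convex combination of images of sets that are all interlaced with the same \<open>n\<close>. Balls
  are convex, so \<open>x\<close> is within about \<open>R \<eta>(1/k)\<close> of the image of \<open>n\<close> (\<open>iter_tail_approx\<close>). As \<open>n\<close>
  may be chosen beyond any given bound, two such \<open>n\<close>, the second beyond the first, have images at
  distance at most about \<open>2 R \<eta>(1/k)\<close>. This is less than \<open>\<delta>\<close> for large \<open>k\<close>, a contradiction.
\<close>

section \<open>Uniformly convex norms and nested convex sets\<close>

text \<open>
  Nearly \<open>p\<close>-minimal points of the sets \<open>C n\<close> form a Cauchy sequence: the midpoint of two of them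
  cannot have much smaller norm than either.
\<close>
lemma uniformly_convex_nested_nonempty:
  fixes p :: "'b::banach \<Rightarrow> real" and C :: "nat \<Rightarrow> 'b set"
  assumes eq: "equivalent_norm p" and uc: "uniformly_convex_norm p"
    and dec: "decseq C" and ne: "\<And>n. C n \<noteq> {}" and cl: "\<And>n. closed (C n)"
    and cv: "\<And>n. convex (C n)" and bd: "bounded (C 0)"
  shows "(\<Inter>n. C n) \<noteq> {}"
proof -
  obtain \<alpha> \<beta> where p: "is_norm p" and \<alpha>: "\<alpha> > 0" and pl: "\<And>x. \<alpha> * norm x \<le> p x"
    and \<beta>: "\<beta> > 0" and pu: "\<And>x. p x \<le> \<beta> * norm x"
    using eq unfolding equivalent_norm_def by blast
  have p0: "p x \<ge> 0" and ps: "p (a *\<^sub>R x) = \<bar>a\<bar> * p x" and pt: "p (x + y) \<le> p x + p y" for a x y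
    using p unfolding is_norm_def by blast+
  obtain K where K: "\<And>x. x \<in> C 0 \<Longrightarrow> norm x \<le> K"
    using bd by (auto simp: bounded_iff)
  define d where "d n = Inf (p ` C n)" for n
  have bb: "bdd_below (p ` S)" for S
    using p0 by (auto simp: bdd_below_def)
  have d_le: "d n \<le> p x" if "x \<in> C n" for n x
    unfolding d_def using that bb by (intro cInf_lower) auto
  have C0: "C n \<subseteq> C 0" for n
    using dec by (simp add: decseq_def)
  have d_bd: "d n \<le> \<beta> * K" for n
  proof -
    obtain x where x: "x \<in> C n" using ne by blast
    have "d n \<le> \<beta> * norm x" using d_le[OF x] pu[of x] by linarith
    also have "\<dots> \<le> \<beta> * K"
      using K C0 x \<beta> by (intro mult_left_mono) auto
    finally show ?thesis .
  qed
  have inc: "incseq d"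
    unfolding incseq_def d_def using dec ne bb
    by (auto intro!: cInf_superset_mono simp: decseq_def)
  obtain D where D: "d \<longlonglongrightarrow> D" and dD: "\<And>n. d n \<le> D"
    using incseq_convergent[OF inc, of "\<beta> * K"] d_bd by blast
  have "\<exists>x\<in>C n. p x < d n + 1 / real (Suc n)" for n
  proof -
    have "\<exists>y\<in>p ` C n. y < d n + 1 / real (Suc n)"
      unfolding d_def using ne by (intro cInf_lessD) auto
    then show ?thesis by auto
  qed
  then obtain x where xC: "\<And>n. x n \<in> C n" and px: "\<And>n. p (x n) < d n + 1 / real (Suc n)"
    by metis
  define a where "a n = p (x n)" for n
  have "(\<lambda>n. d n + 1 / real (Suc n)) \<longlonglongrightarrow> D + 0"
    by (intro tendsto_add D LIMSEQ_Suc[OF lim_1_over_n])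
  then have a: "a \<longlonglongrightarrow> D"
    using D d_le[OF xC] px
    by (intro tendsto_sandwich[of d a sequentially "\<lambda>n. d n + 1 / real (Suc n)"])
       (auto simp: a_def less_imp_le)
  \<comment> \<open>For \<open>D > 0\<close>, uniform convexity is applied to the normalised vectors \<open>x n / p (x n)\<close>.\<close>
  have "\<exists>l. x \<longlonglongrightarrow> l"
  proof (cases "D = 0")
    case True
    have "(\<lambda>n. norm (x n)) \<longlonglongrightarrow> 0"
    proof (rule tendsto_sandwich[of "\<lambda>_. 0" _ _ "\<lambda>n. a n / \<alpha>"])
      show "(\<lambda>n. a n / \<alpha>) \<longlonglongrightarrow> 0"
        using tendsto_divide[OF a tendsto_const[of \<alpha>]] True \<alpha> by simp
      show "\<forall>\<^sub>F n in sequentially. norm (x n) \<le> a n / \<alpha>"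
        using pl \<alpha> by (auto simp: a_def field_simps intro!: always_eventually)
    qed auto
    then show ?thesis by (auto simp: tendsto_norm_zero_iff)
  next
    case False
    have "D \<ge> 0"
      using a by (rule LIMSEQ_le_const) (auto simp: a_def p0)
    with False have Dpos: "D > 0" by simp
    define u where "u n = (1 / a n) *\<^sub>R x n" for n
    have "Cauchy u"
    proof (rule CauchyI)
      fix e :: real assume "e > 0"
      define \<epsilon> where "\<epsilon> = min (\<alpha> * e) 2"
      have "0 < \<epsilon>" "\<epsilon> \<le> 2" using \<open>e > 0\<close> \<alpha> by (auto simp: \<epsilon>_def)
      then obtain \<delta> where \<delta>: "\<delta> > 0"
        and uc': "\<And>x y. p x = 1 \<Longrightarrow> p y = 1 \<Longrightarrow> p (x - y) \<ge> \<epsilon> \<Longrightarrow> p ((1/2) *\<^sub>R (x + y)) \<le> 1 - \<delta>"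
        using uc unfolding uniformly_convex_norm_def by blast
      define h where "h = D * \<delta> / 4"
      have h: "h > 0" using Dpos \<delta> by (simp add: h_def)
      have "\<forall>\<^sub>F n in sequentially. D - h < d n \<and> a n < D + h \<and> 0 < a n"
        using order_tendstoD(1)[OF D, of "D - h"] order_tendstoD(2)[OF a, of "D + h"]
          order_tendstoD(1)[OF a, of 0] h Dpos
        by (auto simp: eventually_conj_iff)
      then obtain N where N: "\<And>n. n \<ge> N \<Longrightarrow> D - h < d n \<and> a n < D + h \<and> 0 < a n"
        by (auto simp: eventually_sequentially)
      have "p (u m - u n) < \<epsilon>" if mn: "N \<le> m" "m \<le> n" for m n
      proof (rule ccontr)
        assume "\<not> p (u m - u n) < \<epsilon>"
        have am: "D - h < d m" "a m < D + h" "0 < a m" and an: "D - h < d n" "a n < D + h" "0 < a n"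
          using N[of m] N[of n] mn by auto
        have dma: "d m \<le> a m" "d n \<le> a n" using d_le[OF xC] by (auto simp: a_def)
        have pu1: "p (u m) = 1" "p (u n) = 1"
          using am an by (auto simp: u_def ps a_def[symmetric])
        have q: "p ((1/2) *\<^sub>R (u m + u n)) \<le> 1 - \<delta>"
          using uc'[OF pu1] \<open>\<not> p (u m - u n) < \<epsilon>\<close> by simp
        have \<delta>1: "0 \<le> 1 - \<delta>" using q p0 order_trans by blast
        have xn: "x n \<in> C m" using xC[of n] dec mn by (auto simp: decseq_def)
        have mid: "(1/2) *\<^sub>R x m + (1/2) *\<^sub>R x n \<in> C m"
          using cv[of m] xC[of m] xn by (intro convexD) auto
        \<comment> \<open>As \<open>a m\<close> and \<open>a n\<close> are close, this midpoint is almost \<open>a m\<close> times that of the unit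
          vectors, so its norm falls below \<open>d m\<close>.\<close>
        have split: "(1/2) *\<^sub>R x m + (1/2) *\<^sub>R x n
            = a m *\<^sub>R ((1/2) *\<^sub>R (u m + u n)) + ((a n - a m) / 2) *\<^sub>R u n"
        proof -
          have "x m = a m *\<^sub>R u m" "x n = a n *\<^sub>R u n"
            using am an by (auto simp: u_def)
          then show ?thesis
            by (simp add: algebra_simps diff_divide_distrib)
        qed
        have "d m \<le> p ((1/2) *\<^sub>R x m + (1/2) *\<^sub>R x n)" by (rule d_le[OF mid])
        also have "\<dots> \<le> a m * p ((1/2) *\<^sub>R (u m + u n)) + \<bar>a n - a m\<bar> / 2"
          unfolding split
          using pt[of "a m *\<^sub>R ((1/2) *\<^sub>R (u m + u n))" "((a n - a m) / 2) *\<^sub>R u n"]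
            ps[of "a m" "(1/2) *\<^sub>R (u m + u n)"] ps[of "(a n - a m) / 2" "u n"]
            abs_of_pos[OF am(3)] abs_divide[of "a n - a m" 2]
          by (simp only: pu1(2) mult_1_right abs_numeral)
        also have "\<dots> \<le> a m * (1 - \<delta>) + \<bar>a n - a m\<bar> / 2"
          using q am by (intro add_right_mono mult_left_mono) auto
        also have "\<dots> \<le> (D + h) * (1 - \<delta>) + h"
          using am an dma \<delta>1 by (intro add_mono mult_right_mono) auto
        finally have "D - h < (D + h) * (1 - \<delta>) + h" using am by linarith
        moreover have "(D + h) * (1 - \<delta>) \<le> D - 4 * h + h"
        proof -
          have "0 \<le> h * \<delta>" using h \<delta> by simp
          moreover have "D * \<delta> = 4 * h" by (simp add: h_def)
          ultimately show ?thesis by (simp add: algebra_simps)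
        qed
        ultimately show False using h by linarith
      qed
      then have *: "norm (u m - u n) < e" if "N \<le> m" "m \<le> n" for m n
      proof -
        have "\<alpha> * norm (u m - u n) < \<alpha> * e"
          using pl[of "u m - u n"] \<open>\<And>m n. N \<le> m \<Longrightarrow> m \<le> n \<Longrightarrow> p (u m - u n) < \<epsilon>\<close>[OF that]
          by (auto simp: \<epsilon>_def)
        then show ?thesis using \<alpha> by simp
      qed
      show "\<exists>M. \<forall>m\<ge>M. \<forall>n\<ge>M. norm (u m - u n) < e"
      proof (intro exI allI impI)
        fix m n assume "N \<le> m" "N \<le> n"
        then show "norm (u m - u n) < e"
          using *[of m n] *[of n m] by (cases "m \<le> n") (auto simp: norm_minus_commute)
      qed
    qed
    then obtain l where "u \<longlonglongrightarrow> l"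
      by (auto simp: Cauchy_convergent_iff convergent_def)
    then have "(\<lambda>n. a n *\<^sub>R u n) \<longlonglongrightarrow> D *\<^sub>R l"
      by (intro tendsto_scaleR a)
    moreover have "\<forall>\<^sub>F n in sequentially. a n *\<^sub>R u n = x n"
      using order_tendstoD(1)[OF a Dpos] by eventually_elim (simp add: u_def)
    ultimately have "x \<longlonglongrightarrow> D *\<^sub>R l"
      by (rule Lim_transform_eventually)
    then show ?thesis by blast
  qed
  then obtain l where l: "x \<longlonglongrightarrow> l" by blast
  have "l \<in> C n" for n
  proof (rule closed_sequentially[OF cl])
    show "(\<lambda>k. x (k + n)) \<longlonglongrightarrow> l" by (rule LIMSEQ_ignore_initial_segment[OF l])
    show "x (k + n) \<in> C n" for k
      using xC[of "k + n"] dec unfolding decseq_def by (meson le_add2 subsetD)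
  qed
  then show ?thesis by blast
qed

section \<open>Iterated tail points\<close>

text \<open>
  The common part of the closed convex hulls of the tails of a sequence. Its points serve as
  substitutes for weak cluster points.
\<close>
definition tail_hull :: "(nat \<Rightarrow> 'b::real_normed_vector) \<Rightarrow> 'b set" where
  "tail_hull y = (\<Inter>N. closure (convex hull (y ` {N..})))"

lemma tail_hull_nonempty:
  fixes p :: "'b::banach \<Rightarrow> real"
  assumes "equivalent_norm p" "uniformly_convex_norm p" "bounded (range y)"
  shows "tail_hull (y :: nat \<Rightarrow> 'b) \<noteq> {}"
  unfolding tail_hull_def
proof (rule uniformly_convex_nested_nonempty[OF assms(1,2)])
  show "decseq (\<lambda>N. closure (convex hull (y ` {N..})))"
    by (intro decseq_SucI closure_mono hull_mono image_mono) auto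
  show "bounded (closure (convex hull (y ` {0..})))"
    using assms(3) by (simp add: bounded_convex_hull bounded_closure atLeast_0)
qed (auto intro: convex_closure)

text \<open>
  A finite multiset of naturals is encoded by the function counting, for each \<open>t\<close>, its members
  \<open>\<ge> t\<close>. The counting function of the singleton of \<open>m\<close> is \<open>step m\<close>, and unions become sums.
\<close>
definition step :: "nat \<Rightarrow> nat \<Rightarrow> nat" where
  "step m t = (if t \<le> m then 1 else 0)"

text \<open>
  The value obtained from \<open>f (v + step m\<^sub>1 + \<dots> + step m\<^sub>j)\<close> by choosing a point of the tail hull
  in the variable \<open>m\<^sub>j\<close>, then \<open>m\<^sub>j\<^sub>-\<^sub>1\<close>, and finally \<open>m\<^sub>1\<close>.
\<close>
primrec iter_tail :: "((nat \<Rightarrow> nat) \<Rightarrow> 'b::real_normed_vector) \<Rightarrow> nat \<Rightarrow> (nat \<Rightarrow> nat) \<Rightarrow> 'b" where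
  "iter_tail f 0 v = f v"
| "iter_tail f (Suc j) v =
     (SOME z. z \<in> tail_hull (\<lambda>m. iter_tail f j (\<lambda>t. v t + step m t)))"

lemma iter_tail_mem:
  fixes f :: "(nat \<Rightarrow> nat) \<Rightarrow> 'b::banach"
  assumes "equivalent_norm p" "uniformly_convex_norm (p :: 'b \<Rightarrow> real)" "bounded (range f)"
  shows "iter_tail f (Suc j) v \<in> tail_hull (\<lambda>m. iter_tail f j (\<lambda>t. v t + step m t))"
proof -
  \<comment> \<open>The bound \<open>K\<close> persists, so that all the sequences whose tail hulls are used are bounded.\<close>
  obtain K where K: "\<And>v. norm (f v) \<le> K"
    using assms(3) by (auto simp: bounded_iff)
  have "norm (iter_tail f j v) \<le> K \<and>
      iter_tail f (Suc j) v \<in> tail_hull (\<lambda>m. iter_tail f j (\<lambda>t. v t + step m t))" for v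
  proof (induction j arbitrary: v)
    case 0
    have "bounded (range (\<lambda>m. iter_tail f 0 (\<lambda>t. v t + step m t)))"
      using K by (auto simp: bounded_iff)
    from tail_hull_nonempty[OF assms(1,2) this] K show ?case
      by (simp add: some_in_eq)
  next
    case (Suc j)
    have bound: "norm (iter_tail f (Suc j) v) \<le> K" for v
    proof -
      let ?y = "\<lambda>m. iter_tail f j (\<lambda>t. v t + step m t)"
      have "iter_tail f (Suc j) v \<in> closure (convex hull (range ?y))"
        using Suc[of v] unfolding tail_hull_def by (auto simp del: iter_tail.simps dest: spec[of _ 0])
      also have "\<dots> \<subseteq> cball 0 K"
        by (intro closure_minimal hull_minimal) (use Suc in \<open>auto simp del: iter_tail.simps\<close>)
      finally show ?thesis by (simp del: iter_tail.simps)
    qed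
    have "bounded (range (\<lambda>m. iter_tail f (Suc j) (\<lambda>t. v t + step m t)))"
      using bound by (auto simp: bounded_iff simp del: iter_tail.simps)
    from tail_hull_nonempty[OF assms(1,2) this] bound show ?case
      by (simp add: some_in_eq)
  qed
  then show ?thesis by blast
qed

section \<open>Staircases and interlacing\<close>

text \<open>
  Contains the counting functions of the multisets of \<open>k\<close> naturals that are all \<open>\<ge> N\<close>.
  Monotonicity is not needed and not required.
\<close>
definition staircase :: "nat \<Rightarrow> nat \<Rightarrow> (nat \<Rightarrow> nat) set" where
  "staircase k N = {w. (\<forall>t. w t \<le> k) \<and> (\<forall>t\<le>N. w t = k) \<and> finite {t. w t \<noteq> 0}}"

text \<open>
  For counting functions of the same total, this says that the members of the two multisets
  alternate, beginning with one of \<open>w\<close> (ties are allowed).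
\<close>
definition interlaced :: "(nat \<Rightarrow> nat) \<Rightarrow> (nat \<Rightarrow> nat) \<Rightarrow> bool" where
  "interlaced w u \<longleftrightarrow> (\<forall>t. w t \<le> u t \<and> u t \<le> Suc (w t))"

lemma staircase_Suc:
  assumes "w \<in> staircase k N'" "N \<le> m" "m \<le> N'"
  shows "(\<lambda>t. step m t + w t) \<in> staircase (Suc k) N"
proof -
  have "{t. step m t + w t \<noteq> 0} \<subseteq> {..m} \<union> {t. w t \<noteq> 0}"
    by (auto simp: step_def)
  then have "finite {t. step m t + w t \<noteq> 0}"
    using assms(1) unfolding staircase_def by (auto intro: finite_subset)
  then show ?thesis
    using assms unfolding staircase_def by (auto simp: step_def le_SucI)
qed

lemma interlaced_Suc:
  assumes "interlaced w u" "w \<in> staircase k N'" "u \<in> staircase k N'" "N \<le> m" "m \<le> N'"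
  shows "interlaced (\<lambda>t. step N t + w t) (\<lambda>t. step m t + u t)"
  unfolding interlaced_def
proof
  fix t
  show "step N t + w t \<le> step m t + u t \<and> step m t + u t \<le> Suc (step N t + w t)"
  proof (cases "t \<le> N'")
    case True
    then have "w t = k" "u t = k" using assms unfolding staircase_def by auto
    then show ?thesis using assms(4) by (auto simp: step_def)
  next
    case False
    then show ?thesis using assms by (auto simp: step_def interlaced_def)
  qed
qed

text \<open>
  Up to \<open>\<epsilon>\<close>, \<open>iter_tail f k v\<close> lies in every closed ball containing the values \<open>f (v + u)\<close> for all
  \<open>u\<close> interlaced with a suitable \<open>w\<close>. The induction on \<open>k\<close> needs one \<open>w\<close> that works for all \<open>v\<close> of
  a finite set, because the first step of \<open>w\<close> is followed by finitely many first steps of \<open>u\<close>.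
\<close>
lemma iter_tail_approx:
  fixes f :: "(nat \<Rightarrow> nat) \<Rightarrow> 'b::banach"
  assumes p: "equivalent_norm p" "uniformly_convex_norm (p :: 'b \<Rightarrow> real)" "bounded (range f)"
    and "finite V" "\<epsilon> > 0"
  shows "\<exists>w\<in>staircase k N. \<forall>v\<in>V. \<forall>y r.
    (\<forall>u\<in>staircase k N. interlaced w u \<longrightarrow> dist y (f (\<lambda>t. v t + u t)) \<le> r) \<longrightarrow>
    dist y (iter_tail f k v) \<le> r + \<epsilon>"
  using assms(4,5)
proof (induction k arbitrary: V N \<epsilon>)
  case 0
  have 1: "(\<lambda>t. 0) \<in> staircase 0 N" by (auto simp: staircase_def)
  have 2: "interlaced (\<lambda>t. 0) (\<lambda>t. 0)" by (auto simp: interlaced_def)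
  have "dist y (iter_tail f 0 v) \<le> r + \<epsilon>"
    if "\<forall>u\<in>staircase 0 N. interlaced (\<lambda>t. 0) u \<longrightarrow> dist y (f (\<lambda>t. v t + u t)) \<le> r" for v y r
    using that[rule_format, OF 1 2] \<open>\<epsilon> > 0\<close> by simp
  with 1 show ?case by blast
next
  case (Suc k)
  let ?y = "\<lambda>v m. iter_tail f k (\<lambda>t. v t + step m t)"
  have "\<exists>M z. finite M \<and> M \<subseteq> {N..} \<and> z \<in> convex hull (?y v ` M) \<and>
      dist z (iter_tail f (Suc k) v) < \<epsilon> / 2" for v
  proof -
    have "iter_tail f (Suc k) v \<in> closure (convex hull (?y v ` {N..}))"
      using iter_tail_mem[OF p] unfolding tail_hull_def by blast
    then obtain z where z: "z \<in> convex hull (?y v ` {N..})"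
      and dz: "dist z (iter_tail f (Suc k) v) < \<epsilon> / 2"
      using \<open>\<epsilon> > 0\<close> unfolding closure_approachable by (meson half_gt_zero)
    obtain S where S: "finite S" "S \<subseteq> ?y v ` {N..}" "z \<in> convex hull S"
      using z unfolding convex_hull_explicit by fast
    with finite_subset_image[OF S(1,2)] dz show ?thesis by blast
  qed
  then obtain M z where M: "\<And>v. finite (M v)" "\<And>v. M v \<subseteq> {N..}"
    and z: "\<And>v. z v \<in> convex hull (?y v ` M v)"
    and dz: "\<And>v. dist (z v) (iter_tail f (Suc k) v) < \<epsilon> / 2"
    by metis
  \<comment> \<open>\<open>w\<close> steps down first at \<open>N\<close>, each \<open>u\<close> at some \<open>m\<close> in \<open>M v\<close>, and every further
    step happens at \<open>N'\<close> or later, hence not before any of these \<open>m\<close>.\<close>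
  define V' where "V' = (\<Union>v\<in>V. (\<lambda>m t. v t + step m t) ` M v)"
  have "finite V'" using Suc.prems(1) M by (auto simp: V'_def)
  define N' where "N' = Max (insert N (\<Union>v\<in>V. M v))"
  have fin: "finite (insert N (\<Union>v\<in>V. M v))" using Suc.prems(1) M by auto
  have N': "N \<le> N'" unfolding N'_def using fin by (intro Max_ge) auto
  have mN': "m \<le> N'" if "v \<in> V" "m \<in> M v" for v m
    unfolding N'_def using fin that by (intro Max_ge) auto
  obtain w where w: "w \<in> staircase k N'" and IH: "\<And>v y r. v \<in> V' \<Longrightarrow>
      (\<And>u. u \<in> staircase k N' \<Longrightarrow> interlaced w u \<Longrightarrow> dist y (f (\<lambda>t. v t + u t)) \<le> r) \<Longrightarrow>
      dist y (iter_tail f k v) \<le> r + \<epsilon> / 2"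
    using Suc.IH[OF \<open>finite V'\<close> half_gt_zero[OF \<open>\<epsilon> > 0\<close>], of N'] by blast
  let ?w = "\<lambda>t. step N t + w t"
  show ?case
  proof (intro bexI[of _ ?w] ballI allI impI)
    show "?w \<in> staircase (Suc k) N" using staircase_Suc[OF w order_refl N'] .
  next
    fix v y r
    assume v: "v \<in> V"
      and r: "\<forall>u\<in>staircase (Suc k) N. interlaced ?w u \<longrightarrow> dist y (f (\<lambda>t. v t + u t)) \<le> r"
    have "dist y (?y v m) \<le> r + \<epsilon> / 2" if m: "m \<in> M v" for m
    proof (rule IH)
      show "(\<lambda>t. v t + step m t) \<in> V'" using v m by (auto simp: V'_def)
      fix u assume u: "u \<in> staircase k N'" "interlaced w u"
      have Nm: "N \<le> m" "m \<le> N'" using M(2) m mN'[OF v m] by auto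
      show "dist y (f (\<lambda>t. v t + step m t + u t)) \<le> r"
        using r[rule_format, OF staircase_Suc[OF u(1) Nm] interlaced_Suc[OF u(2) w u(1) Nm]]
        by (simp add: add.assoc)
    qed
    then have "convex hull (?y v ` M v) \<subseteq> cball y (r + \<epsilon> / 2)"
      by (intro hull_minimal) auto
    with z[of v] have "z v \<in> cball y (r + \<epsilon> / 2)" by blast
    then have "dist y (z v) \<le> r + \<epsilon> / 2" by simp
    with dz[of v] show "dist y (iter_tail f (Suc k) v) \<le> r + \<epsilon>"
      using dist_triangle[of y "iter_tail f (Suc k) v" "z v"] by (simp del: iter_tail.simps)
  qed
qed

section \<open>Staircases as vectors of the unit ball\<close>

text \<open>
  The scaled counting function as a bounded sequence; meaningful only if \<open>w\<close> is bounded, as on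
  staircases.
\<close>
definition stair_vec :: "nat \<Rightarrow> (nat \<Rightarrow> nat) \<Rightarrow> (nat \<Rightarrow>\<^sub>C 'k::real_normed_field)" where
  "stair_vec k w = Bcontfun (\<lambda>t. of_real (real (w t) / real k))"

lemma stair_vec_apply:
  assumes "\<And>t. w t \<le> k"
  shows "apply_bcontfun (stair_vec k w :: nat \<Rightarrow>\<^sub>C 'k::real_normed_field) t = of_real (real (w t) / real k)"
  unfolding stair_vec_def
proof (subst Bcontfun_inverse)
  show "(\<lambda>t. of_real (real (w t) / real k)) \<in> (bcontfun :: (nat \<Rightarrow> 'k) set)"
    by (rule bcontfun_normI[where b = 1]) (use assms in \<open>auto simp: divide_le_eq_1 norm_divide\<close>)
qed simp

lemma stair_vec_c0:
  assumes "w \<in> staircase k N"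
  shows "stair_vec k w \<in> (c0 :: (nat \<Rightarrow>\<^sub>C 'k::real_normed_field) set)"
proof -
  have w: "\<And>t. w t \<le> k" and "finite {t. w t \<noteq> 0}" using assms by (auto simp: staircase_def)
  then have "\<forall>\<^sub>F t in sequentially. w t = 0"
    by (simp flip: cofinite_eq_sequentially add: eventually_cofinite)
  then have "\<forall>\<^sub>F t in sequentially. apply_bcontfun (stair_vec k w :: nat \<Rightarrow>\<^sub>C 'k) t = 0"
    by eventually_elim (simp add: stair_vec_apply[OF w])
  then show ?thesis
    unfolding c0_def by (simp add: tendsto_eventually)
qed

lemma norm_stair_vec:
  assumes "w \<in> staircase k N" "k > 0"
  shows "norm (stair_vec k w :: nat \<Rightarrow>\<^sub>C 'k::real_normed_field) = 1"
proof (rule antisym)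
  have w: "\<And>t. w t \<le> k" using assms by (auto simp: staircase_def)
  show "norm (stair_vec k w :: nat \<Rightarrow>\<^sub>C 'k) \<le> 1"
    by (rule norm_bound) (use w in \<open>auto simp: stair_vec_apply[OF w] norm_divide divide_le_eq_1\<close>)
  have "w 0 = k" using assms by (auto simp: staircase_def)
  then show "1 \<le> norm (stair_vec k w :: nat \<Rightarrow>\<^sub>C 'k)"
    using norm_bounded[of "stair_vec k w :: nat \<Rightarrow>\<^sub>C 'k" 0] assms(2)
    by (simp add: stair_vec_apply[OF w])
qed

lemma dist_stair_vec_interlaced:
  assumes "w \<in> staircase k N" "u \<in> staircase k N" "interlaced w u"
  shows "dist (stair_vec k w :: nat \<Rightarrow>\<^sub>C 'k::real_normed_field) (stair_vec k u) \<le> 1 / real k"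
proof (rule dist_bound)
  fix t
  have w: "\<And>t. w t \<le> k" and u: "\<And>t. u t \<le> k" using assms by (auto simp: staircase_def)
  have "\<bar>real (w t) - real (u t)\<bar> \<le> 1"
    using assms(3) unfolding interlaced_def by (auto dest: spec[of _ t])
  then have "\<bar>real (w t) / real k - real (u t) / real k\<bar> \<le> 1 / real k"
    by (simp flip: diff_divide_distrib add: divide_right_mono)
  then show "dist (apply_bcontfun (stair_vec k w :: nat \<Rightarrow>\<^sub>C 'k) t) (apply_bcontfun (stair_vec k u) t)
      \<le> 1 / real k"
    unfolding stair_vec_apply[OF w] stair_vec_apply[OF u] dist_norm
    by (simp only: norm_of_real flip: of_real_diff)
qed

text \<open>The condition \<open>w N = 0\<close> says that \<open>w\<close> is over before the first step of \<open>u\<close>.\<close>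
lemma dist_stair_vec_ge:
  assumes "w \<in> staircase k M" "u \<in> staircase k N" "w N = 0" "k > 0"
  shows "1 \<le> dist (stair_vec k w :: nat \<Rightarrow>\<^sub>C 'k::real_normed_field) (stair_vec k u)"
proof -
  have w: "\<And>t. w t \<le> k" and u: "\<And>t. u t \<le> k" and "u N = k"
    using assms by (auto simp: staircase_def)
  then show ?thesis
    using dist_bounded[of "stair_vec k w :: nat \<Rightarrow>\<^sub>C 'k" N "stair_vec k u"] assms(3,4)
    by (simp add: stair_vec_apply[OF w] stair_vec_apply[OF u])
qed

section \<open>Quasisymmetric embeddings\<close>

lemma quasisymmetric_le:
  assumes f: "quasisymmetric_embedding \<eta> M N f" and M: "x \<in> M" "y \<in> M" "z \<in> M"
    and "x \<noteq> z" "y \<noteq> z" and t: "t > 0" "dist x y \<le> t * dist x z"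
  shows "dist (f x) (f y) \<le> \<eta> t * dist (f x) (f z)"
proof (cases "x = y")
  case True
  then show ?thesis
    using f t(1) unfolding quasisymmetric_embedding_def quasisymmetric_modulus_def
    by (simp add: less_imp_le)
next
  case False
  have m: "mono_on {0<..} \<eta>" and "inj_on f M"
    using f unfolding quasisymmetric_embedding_def quasisymmetric_modulus_def by auto
  then have fxz: "dist (f x) (f z) > 0" using M \<open>x \<noteq> z\<close> by (auto dest: inj_onD)
  have "dist (f x) (f y) / dist (f x) (f z) \<le> \<eta> (dist x y / dist x z)"
    using f M assms(5,6) False unfolding quasisymmetric_embedding_def by blast
  also have "\<dots> \<le> \<eta> t"
    using t \<open>x \<noteq> z\<close> False by (intro mono_onD[OF m]) (auto simp: field_simps)
  finally show ?thesis using fxz by (simp add: field_simps)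
qed

text \<open>The constant 1 in the maximum covers the degenerate case \<open>y = z\<close>.\<close>
lemma quasisymmetric_le_max:
  assumes f: "quasisymmetric_embedding \<eta> M N f" and M: "x \<in> M" "y \<in> M" "z \<in> M"
    and le: "dist x y \<le> dist x z"
  shows "dist (f x) (f y) \<le> max 1 (\<eta> 1) * dist (f x) (f z)"
proof (cases "x = z \<or> y = z")
  case True
  have "1 * dist (f x) (f z) \<le> max 1 (\<eta> 1) * dist (f x) (f z)"
    by (intro mult_right_mono) auto
  with True le show ?thesis by auto
next
  case False
  then have "dist (f x) (f y) \<le> \<eta> 1 * dist (f x) (f z)"
    using le by (intro quasisymmetric_le[OF f M]) auto
  also have "\<dots> \<le> max 1 (\<eta> 1) * dist (f x) (f z)"
    by (intro mult_right_mono) auto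
  finally show ?thesis .
qed

theorem mainTheorem3:
  assumes "\<exists>p :: 'b::banach \<Rightarrow> real. equivalent_norm p \<and> uniformly_convex_norm p"
  shows "\<not> embeds_quasisymmetrically (c0 :: (nat \<Rightarrow>\<^sub>C 'k::real_normed_field) set) (UNIV :: 'b set)"
proof
  assume "embeds_quasisymmetrically (c0 :: (nat \<Rightarrow>\<^sub>C 'k) set) (UNIV :: 'b set)"
  then obtain \<eta> and F :: "(nat \<Rightarrow>\<^sub>C 'k) \<Rightarrow> 'b" where F: "quasisymmetric_embedding \<eta> c0 UNIV F"
    unfolding embeds_quasisymmetrically_def by blast
  obtain p :: "'b \<Rightarrow> real" where p: "equivalent_norm p" "uniformly_convex_norm p"
    using assms by blast
  define C where "C = max 1 (\<eta> 1)"
  have C: "C \<ge> 1" by (simp add: C_def)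
  note qs = quasisymmetric_le_max[OF F, folded C_def]
  have zero: "0 \<in> (c0 :: (nat \<Rightarrow>\<^sub>C 'k) set)" by (simp add: c0_def)
  define e :: "nat \<Rightarrow>\<^sub>C 'k" where "e = stair_vec 1 (step 0)"
  have step0: "step 0 \<in> staircase 1 0"
    by (auto simp: staircase_def step_def intro: finite_subset[of _ "{0}"])
  have e: "e \<in> c0" "norm e = 1"
    unfolding e_def using stair_vec_c0[OF step0] norm_stair_vec[OF step0] by auto
  define \<rho> where "\<rho> = dist (F 0) (F e)"
  have "inj_on F c0" using F by (simp add: quasisymmetric_embedding_def)
  moreover have "e \<noteq> 0" using e by auto
  ultimately have \<rho>: "\<rho> > 0" using zero e(1) by (auto simp: \<rho>_def dest: inj_onD)
  define \<delta> where "\<delta> = \<rho> / C\<^sup>2"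
  have \<delta>: "\<delta> > 0" using \<rho> C by (auto simp: \<delta>_def)
  have ub: "dist (F 0) (F x) \<le> C * \<rho>" if "x \<in> c0" "norm x = 1" for x
    unfolding \<rho>_def using that e by (intro qs zero) (auto simp: dist_norm)
  have lb: "\<delta> \<le> dist (F x) (F y)" if "x \<in> c0" "y \<in> c0" "norm x = 1" "1 \<le> dist x y" for x y
  proof -
    have "\<rho> \<le> C * dist (F 0) (F x)"
      unfolding \<rho>_def using that e by (intro qs zero) (auto simp: dist_norm)
    also have "dist (F 0) (F x) \<le> C * dist (F x) (F y)"
      unfolding dist_commute[of "F 0"] using that by (intro qs zero) auto
    finally have "\<rho> \<le> C * (C * dist (F x) (F y))"
      using C by simp
    then show ?thesis using C by (simp add: \<delta>_def field_simps power2_eq_square)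
  qed
  have "(\<eta> \<longlongrightarrow> 0) (at_right 0)"
    using F by (simp add: quasisymmetric_embedding_def quasisymmetric_modulus_def)
  then have "\<forall>\<^sub>F t in at_right 0. \<eta> t < \<delta> / (4 * C * \<rho>)"
    using \<delta> \<rho> C by (intro order_tendstoD) auto
  then obtain b where b: "b > 0" "\<And>t. 0 < t \<Longrightarrow> t < b \<Longrightarrow> \<eta> t < \<delta> / (4 * C * \<rho>)"
    unfolding eventually_at_right_field by auto
  obtain k where k: "k > 0" "1 / real k < b"
    using reals_Archimedean[OF b(1)] by (metis inverse_eq_divide zero_less_Suc)
  \<comment> \<open>The default value \<open>F 0\<close> makes \<open>f\<close> bounded on all functions.\<close>
  define f where "f w = (if w \<in> (\<Union>N. staircase k N) then F (stair_vec k w) else F 0)" for w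
  have f: "f w = F (stair_vec k w)" if "w \<in> staircase k N" for w N
    using that by (auto simp: f_def)
  have "dist (F 0) (f w) \<le> C * \<rho>" for w
    using ub[OF stair_vec_c0 norm_stair_vec] k \<rho> C by (auto simp: f_def)
  then have "bounded (range f)"
    unfolding bounded_def by blast
  define x where "x = iter_tail f k (\<lambda>t. 0)"
  have close: "\<exists>w\<in>staircase k N. dist (F (stair_vec k w)) x < \<delta> / 2" for N
  proof -
    obtain w where w: "w \<in> staircase k N" and H: "\<And>y r.
       (\<And>u. u \<in> staircase k N \<Longrightarrow> interlaced w u \<Longrightarrow> dist y (f u) \<le> r) \<Longrightarrow> dist y x \<le> r + \<delta> / 8"
      using iter_tail_approx[OF p \<open>bounded (range f)\<close>, of "{\<lambda>t. 0}" "\<delta> / 8" k N] \<delta>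
      unfolding x_def by auto
    have "dist (F (stair_vec k w)) x \<le> \<delta> / 4 + \<delta> / 8"
    proof (rule H)
      fix u assume u: "u \<in> staircase k N" "interlaced w u"
      have nz: "stair_vec k w \<noteq> (0 :: nat \<Rightarrow>\<^sub>C 'k)" "stair_vec k u \<noteq> (0 :: nat \<Rightarrow>\<^sub>C 'k)"
        using norm_stair_vec[OF w k(1), where 'k = 'k] norm_stair_vec[OF u(1) k(1), where 'k = 'k]
        by auto
      have "dist (F (stair_vec k w)) (F (stair_vec k u))
          \<le> \<eta> (1 / real k) * dist (F (stair_vec k w)) (F 0)"
        using dist_stair_vec_interlaced[OF w u, where 'k = 'k] norm_stair_vec[OF w k(1), where 'k = 'k] k
        by (intro quasisymmetric_le[OF F] stair_vec_c0[OF w] stair_vec_c0[OF u(1)] zero nz) auto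
      also have "\<dots> \<le> \<delta> / (4 * C * \<rho>) * (C * \<rho>)"
        using b(2)[of "1 / real k"] k ub[OF stair_vec_c0[OF w] norm_stair_vec[OF w k(1)]] \<delta> C \<rho>
        by (intro mult_mono) (auto simp: dist_commute)
      also have "\<dots> = \<delta> / 4" using C \<rho> by simp
      finally show "dist (F (stair_vec k w)) (f u) \<le> \<delta> / 4" by (simp add: f[OF u(1)])
    qed
    with w \<delta> show ?thesis by (intro bexI[of _ w]) auto
  qed
  obtain w where w: "w \<in> staircase k 0" "dist (F (stair_vec k w)) x < \<delta> / 2"
    using close by blast
  have "finite {t. w t \<noteq> 0}" using w(1) by (simp add: staircase_def)
  then obtain N where N: "w N = 0"
    using ex_new_if_finite[OF infinite_UNIV_nat] by blast
  obtain u where u: "u \<in> staircase k N" "dist (F (stair_vec k u)) x < \<delta> / 2"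
    using close by blast
  have "\<delta> \<le> dist (F (stair_vec k w)) (F (stair_vec k u))"
    using stair_vec_c0[OF w(1)] stair_vec_c0[OF u(1)] norm_stair_vec[OF w(1) k(1)]
      dist_stair_vec_ge[OF w(1) u(1) N k(1)] by (intro lb) auto
  moreover have "dist (F (stair_vec k w)) (F (stair_vec k u)) < \<delta>"
    using dist_triangle_half_l[OF w(2)] u(2) by blast
  ultimately show False by simp
qed

end
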